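(* Let $(R,r)$ be an epireflector and $\mathbb{T}=(T,\mu,\eta)$ a monad on a category $\mathbf{C}$. Suppose that $R\eta_X:RX\to RTX$ is an epimorphism in $R(\mathbf{C})$ for every object $X$ of $\mathbf{C}$. If for each $X\in\mathbf{C}$ the morphism $\eta_{RTX}:RTX\to TRTX$ is a split monomorphism, then the composite functor $RT$ forms a monad $\mathbb{R}\circ\mathbb{T}$ (the composite monad).
   Context: A reflective subcategory of $\mathbf{C}$ is a full subcategory whose inclusion into $\mathbf{C}$ has a left adjoint $R$; with unit $r:1\to R$, the pair $\mathbb{R}=(R,r)$ is called a reflector, the reflective subcategory is denoted $R(\mathbf{C})$, and $R$ is regarded as an endofunctor of $\mathbf{C}$ (an idempotent monad with unit $r$ and multiplication $(r_R)^{-1}:RR\to R$). $(R,r)$ is an epireflector if each $r_X$ is an epimorphism in $\mathbf{C}$. For a monad $\mathbb{T}=(T,\mu,\eta)$, a $\mathbb{T}$-algebra is a pair $(X,a)$ with $a:TX\to X$ satisfying $a\cdot Ta=a\cdot\mu_X$ and $a\cdot\eta_X=1_X$; a homomorphism $f:(X,a)\to(Y,b)$ is a morphism $f:X\to Y$ with $f\cdot a=b\cdot Tf$. $\mathbf{C}^{\mathbb{T}}$ is the category of $\mathbb{T}$-algebras and $G^{\mathbb{T}}:\mathbf{C}^{\mathbb{T}}\to\mathbf{C}$ the forgetful functor. Composite monad: "$RT$ forms a monad $\mathbb{R}\circ\mathbb{T}$" means that $R$ lifts to $\mathbf{C}^{\mathbb{T}}$, i.e. there is a monad $\tilde{\mathbb{R}}=(\tilde{R},n,d)$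 on $\mathbf{C}^{\mathbb{T}}$ with $G^{\mathbb{T}}\tilde{R}=RG^{\mathbb{T}}$, whose unit $d$ and multiplication $n$ have as underlying natural transformations the unit $rG^{\mathbb{T}}$ and multiplication of $R$. Then $\mathbb{R}\circ\mathbb{T}=(RT,w,r\circ\eta)$, where $(r\circ\eta)_X=r_{TX}\cdot\eta_X$ and, writing $\tilde{R}(TX,\mu_X)=(RTX,\tilde{\mu}_X)$ with $\tilde{\mu}_X:TRTX\to RTX$, $w_X:RTRTX\to RTX$ is the unique morphism with $w_X\cdot r_{TRTX}=\tilde{\mu}_X$. *)

theory Defs
  imports Main
begin

record ('o, 'a) cat =
  Obj :: "'o set"
  Arr :: "'a set"
  Dom :: "'a \<Rightarrow> 'o"
  Cod :: "'a \<Rightarrow> 'o"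
  Idn :: "'o \<Rightarrow> 'a"
  Cmp :: "'a \<Rightarrow> 'a \<Rightarrow> 'a"  (infixl "\<cdot>\<index>" 70)

definition Hom :: "('o, 'a) cat \<Rightarrow> 'o \<Rightarrow> 'o \<Rightarrow> 'a set" where
  "Hom C X Y = {f \<in> Arr C. Dom C f = X \<and> Cod C f = Y}"

locale category =
  fixes C :: "('o, 'a) cat" (structure)
  assumes Dom_in: "f \<in> Arr C \<Longrightarrow> Dom C f \<in> Obj C"
    and Cod_in: "f \<in> Arr C \<Longrightarrow> Cod C f \<in> Obj C"
    and Idn_in: "X \<in> Obj C \<Longrightarrow> Idn C X \<in> Hom C X X"
    and Cmp_in: "f \<in> Hom C X Y \<Longrightarrow> g \<in> Hom C Y Z \<Longrightarrow> g \<cdot> f \<in> Hom C X Z"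
    and Idn_left: "f \<in> Hom C X Y \<Longrightarrow> Idn C Y \<cdot> f = f"
    and Idn_right: "f \<in> Hom C X Y \<Longrightarrow> f \<cdot> Idn C X = f"
    and Cmp_assoc: "f \<in> Hom C X Y \<Longrightarrow> g \<in> Hom C Y Z \<Longrightarrow> h \<in> Hom C Z W \<Longrightarrow>
      (h \<cdot> g) \<cdot> f = h \<cdot> (g \<cdot> f)"

definition epimorphism :: "('o, 'a) cat \<Rightarrow> 'a \<Rightarrow> bool" where
  "epimorphism C f \<longleftrightarrow> f \<in> Arr C \<and>
    (\<forall>Z. \<forall>g \<in> Hom C (Cod C f) Z. \<forall>h \<in> Hom C (Cod C f) Z.
      g \<cdot>\<^bsub>C\<^esub> f = h \<cdot>\<^bsub>C\<^esub> f \<longrightarrow> g = h)"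

definition split_monomorphism :: "('o, 'a) cat \<Rightarrow> 'a \<Rightarrow> bool" where
  "split_monomorphism C f \<longleftrightarrow> f \<in> Arr C \<and>
    (\<exists>s \<in> Hom C (Cod C f) (Dom C f). s \<cdot>\<^bsub>C\<^esub> f = Idn C (Dom C f))"

definition inverse_arrow :: "('o, 'a) cat \<Rightarrow> 'a \<Rightarrow> 'a" where
  "inverse_arrow C f = (THE g. g \<in> Hom C (Cod C f) (Dom C f) \<and>
    g \<cdot>\<^bsub>C\<^esub> f = Idn C (Dom C f) \<and> f \<cdot>\<^bsub>C\<^esub> g = Idn C (Cod C f))"

definition full_subcat :: "('o, 'a) cat \<Rightarrow> 'o set \<Rightarrow> ('o, 'a) cat" where
  "full_subcat C B = C\<lparr>Obj := B, Arr := {f \<in> Arr C. Dom C f \<in> B \<and> Cod C f \<in> B}\<rparr>"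

record ('o, 'a, 'p, 'b) fct =
  omap :: "'o \<Rightarrow> 'p"
  amap :: "'a \<Rightarrow> 'b"

locale cat_functor = source: category C + target: category D
  for C :: "('o, 'a) cat" and D :: "('p, 'b) cat" +
  fixes F :: "('o, 'a, 'p, 'b) fct"
  assumes omap_in: "X \<in> Obj C \<Longrightarrow> omap F X \<in> Obj D"
    and amap_in: "f \<in> Hom C X Y \<Longrightarrow> amap F f \<in> Hom D (omap F X) (omap F Y)"
    and amap_Idn: "X \<in> Obj C \<Longrightarrow> amap F (Idn C X) = Idn D (omap F X)"
    and amap_Cmp: "f \<in> Hom C X Y \<Longrightarrow> g \<in> Hom C Y Z \<Longrightarrow>
      amap F (g \<cdot>\<^bsub>C\<^esub> f) = amap F g \<cdot>\<^bsub>D\<^esub> amap F f"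

(* Serves both as the identity functor and as the inclusion of a subcategory. *)
definition id_fct :: "('o, 'a, 'o, 'a) fct" where
  "id_fct = \<lparr>omap = (\<lambda>X. X), amap = (\<lambda>f. f)\<rparr>"

definition comp_fct ::
  "('p, 'b, 'q, 'c) fct \<Rightarrow> ('o, 'a, 'p, 'b) fct \<Rightarrow> ('o, 'a, 'q, 'c) fct"  (infixr "\<circ>\<^sub>F" 75) where
  "G \<circ>\<^sub>F F = \<lparr>omap = (\<lambda>X. omap G (omap F X)), amap = (\<lambda>f. amap G (amap F f))\<rparr>"

(* Values outside Obj C and Arr C are meaningless and must not be compared. *)
definition fct_eq_on ::
  "('o, 'a) cat \<Rightarrow> ('o, 'a, 'p, 'b) fct \<Rightarrow> ('o, 'a, 'p, 'b) fct \<Rightarrow> bool" where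
  "fct_eq_on C F G \<longleftrightarrow>
    (\<forall>X \<in> Obj C. omap F X = omap G X) \<and> (\<forall>f \<in> Arr C. amap F f = amap G f)"

locale nat_trans = source_functor: cat_functor C D F + target_functor: cat_functor C D G
  for C :: "('o, 'a) cat" and D :: "('p, 'b) cat" and F G +
  fixes \<alpha> :: "'o \<Rightarrow> 'b"
  assumes component_in: "X \<in> Obj C \<Longrightarrow> \<alpha> X \<in> Hom D (omap F X) (omap G X)"
    and naturality: "f \<in> Hom C X Y \<Longrightarrow> \<alpha> Y \<cdot>\<^bsub>D\<^esub> amap F f = amap G f \<cdot>\<^bsub>D\<^esub> \<alpha> X"

locale adjunction =
  left_adjoint: cat_functor C D F + right_adjoint: cat_functor D C G +
  unit: nat_trans C C id_fct "G \<circ>\<^sub>F F" \<eta> + counit: nat_trans D D "F \<circ>\<^sub>F G" id_fct \<epsilon>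
  for C :: "('o, 'a) cat" and D :: "('p, 'b) cat" and F G \<eta> \<epsilon> +
  assumes triangle_left: "X \<in> Obj C \<Longrightarrow>
      \<epsilon> (omap F X) \<cdot>\<^bsub>D\<^esub> amap F (\<eta> X) = Idn D (omap F X)"
    and triangle_right: "Y \<in> Obj D \<Longrightarrow>
      amap G (\<epsilon> Y) \<cdot>\<^bsub>C\<^esub> \<eta> (omap G Y) = Idn C (omap G Y)"

locale monad =
  endofunctor: cat_functor C C T +
  unit: nat_trans C C id_fct T \<eta> + multiplication: nat_trans C C "T \<circ>\<^sub>F T" T \<mu>
  for C :: "('o, 'a) cat" and T \<mu> \<eta> +
  assumes unit_left: "X \<in> Obj C \<Longrightarrow> \<mu> X \<cdot>\<^bsub>C\<^esub> \<eta> (omap T X) = Idn C (omap T X)"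
    and unit_right: "X \<in> Obj C \<Longrightarrow> \<mu> X \<cdot>\<^bsub>C\<^esub> amap T (\<eta> X) = Idn C (omap T X)"
    and associativity: "X \<in> Obj C \<Longrightarrow>
      \<mu> X \<cdot>\<^bsub>C\<^esub> \<mu> (omap T X) = \<mu> X \<cdot>\<^bsub>C\<^esub> amap T (\<mu> X)"

(* B is the class of objects of the reflective subcategory R(C). Since the inclusion is the
   identity on objects and arrows, R also denotes the induced endofunctor of C. *)
definition reflector ::
  "('o, 'a) cat \<Rightarrow> 'o set \<Rightarrow> ('o, 'a, 'o, 'a) fct \<Rightarrow> ('o \<Rightarrow> 'a) \<Rightarrow> bool" where
  "reflector C B R r \<longleftrightarrow> category C \<and> B \<subseteq> Obj C \<and>
    (\<exists>\<epsilon>. adjunction C (full_subcat C B) R id_fct r \<epsilon>)"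

definition epireflector ::
  "('o, 'a) cat \<Rightarrow> 'o set \<Rightarrow> ('o, 'a, 'o, 'a) fct \<Rightarrow> ('o \<Rightarrow> 'a) \<Rightarrow> bool" where
  "epireflector C B R r \<longleftrightarrow> reflector C B R r \<and> (\<forall>X \<in> Obj C. epimorphism C (r X))"

definition refl_mult ::
  "('o, 'a) cat \<Rightarrow> ('o, 'a, 'o, 'a) fct \<Rightarrow> ('o \<Rightarrow> 'a) \<Rightarrow> 'o \<Rightarrow> 'a" where
  "refl_mult C R r X = inverse_arrow C (r (omap R X))"

type_synonym ('o, 'a) alg = "'o \<times> 'a"
type_synonym ('o, 'a) alg_arr = "('o, 'a) alg \<times> 'a \<times> ('o, 'a) alg"

definition algebras ::
  "('o, 'a) cat \<Rightarrow> ('o, 'a, 'o, 'a) fct \<Rightarrow> ('o \<Rightarrow> 'a) \<Rightarrow> ('o \<Rightarrow> 'a) \<Rightarrow> ('o, 'a) alg set" where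
  "algebras C T \<mu> \<eta> = {(X, a). X \<in> Obj C \<and> a \<in> Hom C (omap T X) X \<and>
    a \<cdot>\<^bsub>C\<^esub> amap T a = a \<cdot>\<^bsub>C\<^esub> \<mu> X \<and> a \<cdot>\<^bsub>C\<^esub> \<eta> X = Idn C X}"

definition alg_homs ::
  "('o, 'a) cat \<Rightarrow> ('o, 'a, 'o, 'a) fct \<Rightarrow> ('o, 'a) alg \<Rightarrow> ('o, 'a) alg \<Rightarrow> 'a set" where
  "alg_homs C T = (\<lambda>(X, a) (Y, b).
    {f \<in> Hom C X Y. f \<cdot>\<^bsub>C\<^esub> a = b \<cdot>\<^bsub>C\<^esub> amap T f})"

(* An arrow is a triple (A, f, A') since f alone does not determine the algebras A and A'. *)
definition alg_cat ::
  "('o, 'a) cat \<Rightarrow> ('o, 'a, 'o, 'a) fct \<Rightarrow> ('o \<Rightarrow> 'a) \<Rightarrow> ('o \<Rightarrow> 'a) \<Rightarrow>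
    (('o, 'a) alg, ('o, 'a) alg_arr) cat" where
  "alg_cat C T \<mu> \<eta> =
    \<lparr>Obj = algebras C T \<mu> \<eta>,
     Arr = {(A, f, A'). A \<in> algebras C T \<mu> \<eta> \<and> A' \<in> algebras C T \<mu> \<eta> \<and> f \<in> alg_homs C T A A'},
     Dom = (\<lambda>(A, f, A'). A),
     Cod = (\<lambda>(A, f, A'). A'),
     Idn = (\<lambda>A. (A, Idn C (fst A), A)),
     Cmp = (\<lambda>(_, g, A'') (A, f, _). (A, g \<cdot>\<^bsub>C\<^esub> f, A''))\<rparr>"

definition forget_fct :: "(('o, 'a) alg, ('o, 'a) alg_arr, 'o, 'a) fct" where
  "forget_fct = \<lparr>omap = (\<lambda>(X, a). X), amap = (\<lambda>(A, f, A'). f)\<rparr>"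

definition is_lifting ::
  "('o, 'a) cat \<Rightarrow> ('o, 'a, 'o, 'a) fct \<Rightarrow> ('o \<Rightarrow> 'a) \<Rightarrow>
    ('o, 'a, 'o, 'a) fct \<Rightarrow> ('o \<Rightarrow> 'a) \<Rightarrow> ('o \<Rightarrow> 'a) \<Rightarrow>
    (('o, 'a) alg, ('o, 'a) alg_arr, ('o, 'a) alg, ('o, 'a) alg_arr) fct \<Rightarrow>
    (('o, 'a) alg \<Rightarrow> ('o, 'a) alg_arr) \<Rightarrow> (('o, 'a) alg \<Rightarrow> ('o, 'a) alg_arr) \<Rightarrow> bool" where
  "is_lifting C R r T \<mu> \<eta> R' n d \<longleftrightarrow>
    monad (alg_cat C T \<mu> \<eta>) R' n d \<and>
    fct_eq_on (alg_cat C T \<mu> \<eta>) (forget_fct \<circ>\<^sub>F R') (R \<circ>\<^sub>F forget_fct) \<and>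
    (\<forall>A \<in> Obj (alg_cat C T \<mu> \<eta>).
      amap forget_fct (d A) = r (omap forget_fct A) \<and>
      amap forget_fct (n A) = refl_mult C R r (omap forget_fct A))"

(* snd (omap R' (omap T X, \<mu> X)) is the structure map TRTX \<rightarrow> RTX of the lifted free algebra. *)
definition is_composite_mult ::
  "('o, 'a) cat \<Rightarrow> ('o, 'a, 'o, 'a) fct \<Rightarrow> ('o \<Rightarrow> 'a) \<Rightarrow>
    ('o, 'a, 'o, 'a) fct \<Rightarrow> ('o \<Rightarrow> 'a) \<Rightarrow>
    (('o, 'a) alg, ('o, 'a) alg_arr, ('o, 'a) alg, ('o, 'a) alg_arr) fct \<Rightarrow>
    ('o \<Rightarrow> 'a) \<Rightarrow> bool" where
  "is_composite_mult C R r T \<mu> R' w \<longleftrightarrow>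
    (\<forall>X \<in> Obj C. \<forall>v.
      v \<in> Hom C (omap (R \<circ>\<^sub>F T \<circ>\<^sub>F R \<circ>\<^sub>F T) X) (omap (R \<circ>\<^sub>F T) X) \<and>
      v \<cdot>\<^bsub>C\<^esub> r (omap (T \<circ>\<^sub>F R \<circ>\<^sub>F T) X) = snd (omap R' (omap T X, \<mu> X))
      \<longleftrightarrow> v = w X)"

definition forms_composite_monad ::
  "('o, 'a) cat \<Rightarrow> ('o, 'a, 'o, 'a) fct \<Rightarrow> ('o \<Rightarrow> 'a) \<Rightarrow>
    ('o, 'a, 'o, 'a) fct \<Rightarrow> ('o \<Rightarrow> 'a) \<Rightarrow> ('o \<Rightarrow> 'a) \<Rightarrow> bool" where
  "forms_composite_monad C R r T \<mu> \<eta> \<longleftrightarrow>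
    (\<exists>R' n d w. is_lifting C R r T \<mu> \<eta> R' n d \<and>
      is_composite_mult C R r T \<mu> R' w \<and>
      monad C (R \<circ>\<^sub>F T) w (\<lambda>X. r (omap T X) \<cdot>\<^bsub>C\<^esub> \<eta> X))"

end

theory Submission
  imports Defs
begin

text \<open>
  Write \<open>B\<close> for the class of objects of \<open>R(C)\<close>. The proof rests on one cancellation principle
  (\<open>unit_cancel\<close>): two arrows \<open>f, g : TZ \<rightarrow> Y\<close> with \<open>Y \<in> B\<close> and \<open>f \<cdot> \<eta>\<^sub>Z = g \<cdot> \<eta>\<^sub>Z\<close> are equal, because
  they factor through \<open>r\<^sub>T\<^sub>Z\<close>, and \<open>r\<^sub>T\<^sub>Z \<cdot> \<eta>\<^sub>Z = R\<eta>\<^sub>Z \<cdot> r\<^sub>Z\<close> is right-cancellable against objects of \<open>B\<close>.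

  Over \<open>B\<close>, then, algebra structures are merely retractions of the unit. If \<open>Y \<in> B\<close>, any retraction
  \<open>s\<close> of \<open>\<eta>\<^sub>Y\<close> is unique and is a \<open>T\<close>-algebra structure (\<open>retraction_is_algebra\<close>), and every arrow of
  \<open>C\<close> from the carrier of an algebra to the carrier \<open>Y\<close> of such an algebra is a homomorphism
  (\<open>alg_homs_into_subcat\<close>): each of these equations between arrows into \<open>Y\<close> can be tested after
  composing with a unit, where it is trivial.

  Lifting \<open>R\<close> to algebras thus amounts to finding, for every algebra \<open>(X, a)\<close>, some retraction of
  \<open>\<eta>\<^sub>R\<^sub>X\<close>. For free algebras this is the split monomorphism hypothesis; since \<open>\<eta>\<^sub>X\<close> and \<open>a\<close> make \<open>X\<close> a
  retract of \<open>TX\<close>, the object \<open>RX\<close> is a retract of \<open>RTX\<close>, and the splitting passes to it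
  (\<open>unit_split_mono_of_algebra\<close>).

  The monad laws, both for the lifted reflector and for \<open>RT\<close>, come from a single fact on pointed
  endofunctors (\<open>monad_if_unit_cancellable\<close>). In the case of \<open>RT\<close> this shows that the composite monad
  is idempotent: its multiplication is the unique retraction of its unit at \<open>RTX\<close>.
\<close>

section \<open>Functors and idempotent monads\<close>

lemma cat_functor_id:
  assumes "category C"
  shows "cat_functor C C id_fct"
  using assms by (intro cat_functor.intro cat_functor_axioms.intro) (auto simp: id_fct_def)

lemma cat_functor_comp:
  assumes "cat_functor C D F" and "cat_functor D E G"
  shows "cat_functor C E (G \<circ>\<^sub>F F)"
proof -
  interpret F: cat_functor C D F by fact
  interpret G: cat_functor D E G by fact
  show ?thesis
    by (intro cat_functor.intro cat_functor_axioms.intro F.source.category_axioms G.target.category_axioms)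
      (auto simp: comp_fct_def F.omap_in G.omap_in F.amap_Idn G.amap_Idn F.amap_Cmp
        intro: G.amap_in F.amap_in G.amap_Cmp[OF F.amap_in F.amap_in])
qed

text \<open>
  The hypotheses say that \<open>w\<close> retracts \<open>e\<^sub>S\<close> and that an arrow \<open>SX \<rightarrow> SY\<close> is determined by its
  composite with \<open>e\<^sub>X\<close>. Then \<open>S\<close> is an idempotent monad: by cancellation each monad law, and the
  naturality of \<open>w\<close>, only has to hold after composing with a component of \<open>e\<close>, where naturality
  of \<open>e\<close> and the retraction property give it.
\<close>
lemma monad_if_unit_cancellable:
  assumes e: "nat_trans C C id_fct S e"
    and w_in: "\<And>X. X \<in> Obj C \<Longrightarrow> w X \<in> Hom C (omap S (omap S X)) (omap S X)"
    and w_retracts: "\<And>X. X \<in> Obj C \<Longrightarrow> w X \<cdot>\<^bsub>C\<^esub> e (omap S X) = Idn C (omap S X)"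
    and cancel: "\<And>X Y f g. \<lbrakk>X \<in> Obj C; Y \<in> Obj C; f \<in> Hom C (omap S X) (omap S Y);
      g \<in> Hom C (omap S X) (omap S Y); f \<cdot>\<^bsub>C\<^esub> e X = g \<cdot>\<^bsub>C\<^esub> e X\<rbrakk> \<Longrightarrow> f = g"
  shows "monad C S w e"
proof -
  interpret S: cat_functor C C S using e by (simp add: nat_trans_def)
  interpret e: nat_trans C C id_fct S e by (rule e)
  have S_in: "omap S X \<in> Obj C" if "X \<in> Obj C" for X
    using that by (rule S.omap_in)
  have e_in: "e X \<in> Hom C X (omap S X)" if "X \<in> Obj C" for X
    using e.component_in[OF that] by (simp add: id_fct_def)
  have e_nat: "e Y \<cdot>\<^bsub>C\<^esub> f = amap S f \<cdot>\<^bsub>C\<^esub> e X" if "f \<in> Hom C X Y" for f X Y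
    using e.naturality[OF that] by (simp add: id_fct_def)
  have Hom_obj: "X \<in> Obj C" "Y \<in> Obj C" if "f \<in> Hom C X Y" for f X Y
    using that S.source.Dom_in S.source.Cod_in by (auto simp: Hom_def)
  \<comment> \<open>The arrow \<open>w \<cdot> Sf\<close> extends \<open>f\<close> along the unit, as in a Kleisli extension.\<close>
  have w_section: "w Y \<cdot>\<^bsub>C\<^esub> amap S f \<cdot>\<^bsub>C\<^esub> e X = f"
    if f: "f \<in> Hom C X (omap S Y)" and Y: "Y \<in> Obj C" for f X Y
  proof -
    have X: "X \<in> Obj C" using Hom_obj f by blast
    have "w Y \<cdot>\<^bsub>C\<^esub> amap S f \<cdot>\<^bsub>C\<^esub> e X = w Y \<cdot>\<^bsub>C\<^esub> (e (omap S Y) \<cdot>\<^bsub>C\<^esub> f)"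
      using S.source.Cmp_assoc[OF e_in[OF X] S.amap_in[OF f] w_in[OF Y]] e_nat[OF f] by simp
    also have "\<dots> = f"
      using S.source.Cmp_assoc[OF f e_in[OF S_in[OF Y]] w_in[OF Y]] w_retracts[OF Y]
        S.source.Idn_left[OF f] by simp
    finally show ?thesis .
  qed
  have w_nat: "w Y \<cdot>\<^bsub>C\<^esub> amap S (amap S f) = amap S f \<cdot>\<^bsub>C\<^esub> w X" if f: "f \<in> Hom C X Y" for f X Y
  proof (rule cancel)
    note XY = Hom_obj[OF f] and Sf = S.amap_in[OF f]
    show "omap S X \<in> Obj C" "Y \<in> Obj C" using XY S_in by auto
    show "w Y \<cdot>\<^bsub>C\<^esub> amap S (amap S f) \<in> Hom C (omap S (omap S X)) (omap S Y)"
      by (rule S.source.Cmp_in[OF S.amap_in[OF Sf] w_in[OF XY(2)]])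
    show "amap S f \<cdot>\<^bsub>C\<^esub> w X \<in> Hom C (omap S (omap S X)) (omap S Y)"
      by (rule S.source.Cmp_in[OF w_in[OF XY(1)] Sf])
    show "w Y \<cdot>\<^bsub>C\<^esub> amap S (amap S f) \<cdot>\<^bsub>C\<^esub> e (omap S X) = amap S f \<cdot>\<^bsub>C\<^esub> w X \<cdot>\<^bsub>C\<^esub> e (omap S X)"
      using w_section[OF Sf XY(2)] w_retracts[OF XY(1)] S.source.Idn_right[OF Sf]
        S.source.Cmp_assoc[OF e_in[OF S_in[OF XY(1)]] w_in[OF XY(1)] Sf] by simp
  qed
  have unit_right: "w X \<cdot>\<^bsub>C\<^esub> amap S (e X) = Idn C (omap S X)" if X: "X \<in> Obj C" for X
  proof (rule cancel[OF X X])
    show "w X \<cdot>\<^bsub>C\<^esub> amap S (e X) \<in> Hom C (omap S X) (omap S X)"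
      by (rule S.source.Cmp_in[OF S.amap_in[OF e_in[OF X]] w_in[OF X]])
    show "Idn C (omap S X) \<in> Hom C (omap S X) (omap S X)"
      by (rule S.source.Idn_in[OF S_in[OF X]])
    show "w X \<cdot>\<^bsub>C\<^esub> amap S (e X) \<cdot>\<^bsub>C\<^esub> e X = Idn C (omap S X) \<cdot>\<^bsub>C\<^esub> e X"
      using w_section[OF e_in[OF X] X] S.source.Idn_left[OF e_in[OF X]] by simp
  qed
  have associativity: "w X \<cdot>\<^bsub>C\<^esub> w (omap S X) = w X \<cdot>\<^bsub>C\<^esub> amap S (w X)" if X: "X \<in> Obj C" for X
  proof (rule cancel)
    note X2 = S_in[OF X] and X3 = S_in[OF S_in[OF X]]
    show "omap S (omap S X) \<in> Obj C" "X \<in> Obj C" using X X3 by auto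
    show "w X \<cdot>\<^bsub>C\<^esub> w (omap S X) \<in> Hom C (omap S (omap S (omap S X))) (omap S X)"
      by (rule S.source.Cmp_in[OF w_in[OF X2] w_in[OF X]])
    show "w X \<cdot>\<^bsub>C\<^esub> amap S (w X) \<in> Hom C (omap S (omap S (omap S X))) (omap S X)"
      by (rule S.source.Cmp_in[OF S.amap_in[OF w_in[OF X]] w_in[OF X]])
    show "w X \<cdot>\<^bsub>C\<^esub> w (omap S X) \<cdot>\<^bsub>C\<^esub> e (omap S (omap S X))
        = w X \<cdot>\<^bsub>C\<^esub> amap S (w X) \<cdot>\<^bsub>C\<^esub> e (omap S (omap S X))"
      using w_section[OF w_in[OF X] X] w_retracts[OF X2] S.source.Idn_right[OF w_in[OF X]]
        S.source.Cmp_assoc[OF e_in[OF X3] w_in[OF X2] w_in[OF X]] by simp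
  qed
  have SS: "cat_functor C C (S \<circ>\<^sub>F S)"
    by (rule cat_functor_comp[OF S.cat_functor_axioms S.cat_functor_axioms])
  have "nat_trans C C (S \<circ>\<^sub>F S) S w"
    by (intro nat_trans.intro nat_trans_axioms.intro SS S.cat_functor_axioms)
      (auto simp: comp_fct_def w_in w_nat)
  then show ?thesis
    by (intro monad.intro monad_axioms.intro S.cat_functor_axioms e)
      (auto simp: w_retracts unit_right associativity)
qed

section \<open>The category of algebras\<close>

lemma algebrasD:
  assumes "(X, a) \<in> algebras C T \<mu> \<eta>"
  shows "X \<in> Obj C" and "a \<in> Hom C (omap T X) X"
    and "a \<cdot>\<^bsub>C\<^esub> amap T a = a \<cdot>\<^bsub>C\<^esub> \<mu> X" and "a \<cdot>\<^bsub>C\<^esub> \<eta> X = Idn C X"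
  using assms by (auto simp: algebras_def)

lemma Hom_alg_cat_iff:
  "(A, f, A') \<in> Hom (alg_cat C T \<mu> \<eta>) P Q \<longleftrightarrow>
    A = P \<and> A' = Q \<and> P \<in> algebras C T \<mu> \<eta> \<and> Q \<in> algebras C T \<mu> \<eta> \<and> f \<in> alg_homs C T P Q"
  by (auto simp: Hom_def alg_cat_def)

lemma Hom_alg_catE:
  assumes "h \<in> Hom (alg_cat C T \<mu> \<eta>) P Q"
  obtains X a Y b f where "P = (X, a)" and "Q = (Y, b)" and "h = (P, f, Q)"
    and "P \<in> algebras C T \<mu> \<eta>" and "Q \<in> algebras C T \<mu> \<eta>"
    and "f \<in> Hom C X Y" and "f \<cdot>\<^bsub>C\<^esub> a = b \<cdot>\<^bsub>C\<^esub> amap T f"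
  using assms by (cases P; cases Q; cases h) (auto simp: Hom_alg_cat_iff alg_homs_def)

lemma alg_cat_simps:
  "Obj (alg_cat C T \<mu> \<eta>) = algebras C T \<mu> \<eta>"
  "Idn (alg_cat C T \<mu> \<eta>) A = (A, Idn C (fst A), A)"
  "(P', g, P'') \<cdot>\<^bsub>alg_cat C T \<mu> \<eta>\<^esub> (P, f, Q) = (P, g \<cdot>\<^bsub>C\<^esub> f, P'')"
  by (auto simp: alg_cat_def)

lemma category_alg_cat:
  assumes "cat_functor C C T"
  shows "category (alg_cat C T \<mu> \<eta>)"
proof -
  interpret T: cat_functor C C T by fact
  show ?thesis
  proof
    show "Dom (alg_cat C T \<mu> \<eta>) h \<in> Obj (alg_cat C T \<mu> \<eta>)"
      and "Cod (alg_cat C T \<mu> \<eta>) h \<in> Obj (alg_cat C T \<mu> \<eta>)"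
      if "h \<in> Arr (alg_cat C T \<mu> \<eta>)" for h
      using that by (auto simp: alg_cat_def)
  next
    fix A assume A: "A \<in> Obj (alg_cat C T \<mu> \<eta>)"
    obtain X a where [simp]: "A = (X, a)" by (cases A)
    have alg: "(X, a) \<in> algebras C T \<mu> \<eta>" using A by (simp add: alg_cat_simps)
    note D = algebrasD[OF alg]
    show "Idn (alg_cat C T \<mu> \<eta>) A \<in> Hom (alg_cat C T \<mu> \<eta>) A A"
      using alg T.source.Idn_in[OF D(1)] T.source.Idn_left[OF D(2)] T.source.Idn_right[OF D(2)]
      by (simp add: alg_cat_simps Hom_alg_cat_iff alg_homs_def T.amap_Idn D(1))
  next
    fix g h P Q S
    assume g: "g \<in> Hom (alg_cat C T \<mu> \<eta>) P Q" and h: "h \<in> Hom (alg_cat C T \<mu> \<eta>) Q S"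
    obtain X a Y b f where [simp]: "P = (X, a)" "Q = (Y, b)" "g = (P, f, Q)"
      and PQ: "P \<in> algebras C T \<mu> \<eta>" "Q \<in> algebras C T \<mu> \<eta>"
      and f: "f \<in> Hom C X Y" "f \<cdot>\<^bsub>C\<^esub> a = b \<cdot>\<^bsub>C\<^esub> amap T f"
      by (rule Hom_alg_catE[OF g])
    obtain Z c k where [simp]: "S = (Z, c)" "h = (Q, k, S)" and S: "S \<in> algebras C T \<mu> \<eta>"
      and k: "k \<in> Hom C Y Z" "k \<cdot>\<^bsub>C\<^esub> b = c \<cdot>\<^bsub>C\<^esub> amap T k"
      by (rule Hom_alg_catE[OF h]) auto
    have a: "a \<in> Hom C (omap T X) X" and b: "b \<in> Hom C (omap T Y) Y"
      and c: "c \<in> Hom C (omap T Z) Z"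
      using PQ S by (auto dest: algebrasD)
    have "(k \<cdot>\<^bsub>C\<^esub> f) \<cdot>\<^bsub>C\<^esub> a = k \<cdot>\<^bsub>C\<^esub> (b \<cdot>\<^bsub>C\<^esub> amap T f)"
      using T.source.Cmp_assoc[OF a f(1) k(1)] f(2) by simp
    also have "\<dots> = c \<cdot>\<^bsub>C\<^esub> amap T k \<cdot>\<^bsub>C\<^esub> amap T f"
      using T.source.Cmp_assoc[OF T.amap_in[OF f(1)] b k(1)] k(2) by simp
    also have "\<dots> = c \<cdot>\<^bsub>C\<^esub> amap T (k \<cdot>\<^bsub>C\<^esub> f)"
      using T.source.Cmp_assoc[OF T.amap_in[OF f(1)] T.amap_in[OF k(1)] c]
        T.amap_Cmp[OF f(1) k(1)] by simp
    finally show "h \<cdot>\<^bsub>alg_cat C T \<mu> \<eta>\<^esub> g \<in> Hom (alg_cat C T \<mu> \<eta>) P S"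
      using PQ S T.source.Cmp_in[OF f(1) k(1)]
      by (simp add: alg_cat_simps Hom_alg_cat_iff alg_homs_def)
  next
    fix g P Q
    assume g: "g \<in> Hom (alg_cat C T \<mu> \<eta>) P Q"
    show "Idn (alg_cat C T \<mu> \<eta>) Q \<cdot>\<^bsub>alg_cat C T \<mu> \<eta>\<^esub> g = g"
      and "g \<cdot>\<^bsub>alg_cat C T \<mu> \<eta>\<^esub> Idn (alg_cat C T \<mu> \<eta>) P = g"
      by (rule Hom_alg_catE[OF g],
          simp add: alg_cat_simps T.source.Idn_left T.source.Idn_right)+
  next
    fix g h k P Q S V
    assume g: "g \<in> Hom (alg_cat C T \<mu> \<eta>) P Q" and h: "h \<in> Hom (alg_cat C T \<mu> \<eta>) Q S"
      and k: "k \<in> Hom (alg_cat C T \<mu> \<eta>) S V"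
    show "k \<cdot>\<^bsub>alg_cat C T \<mu> \<eta>\<^esub> h \<cdot>\<^bsub>alg_cat C T \<mu> \<eta>\<^esub> g
        = k \<cdot>\<^bsub>alg_cat C T \<mu> \<eta>\<^esub> (h \<cdot>\<^bsub>alg_cat C T \<mu> \<eta>\<^esub> g)"
      by (rule Hom_alg_catE[OF g]; rule Hom_alg_catE[OF h]; rule Hom_alg_catE[OF k])
        (auto simp: alg_cat_simps intro: T.source.Cmp_assoc)
  qed
qed

section \<open>Epireflections\<close>

lemma full_subcat_simps:
  "Dom (full_subcat C B) = Dom C" "Cod (full_subcat C B) = Cod C"
  "Idn (full_subcat C B) = Idn C" "Cmp (full_subcat C B) = Cmp C"
  "Obj (full_subcat C B) = B"
  by (auto simp: full_subcat_def)

lemma Hom_full_subcat: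
  "f \<in> Hom (full_subcat C B) X Y \<longleftrightarrow> f \<in> Hom C X Y \<and> X \<in> B \<and> Y \<in> B"
  by (auto simp: Hom_def full_subcat_def)

locale epireflection = category C
  for C :: "('o, 'a) cat" (structure) +
  fixes B :: "'o set" and R :: "('o, 'a, 'o, 'a) fct" and r :: "'o \<Rightarrow> 'a"
  assumes epireflector: "epireflector C B R r"
begin

lemma subcat_obj: "Y \<in> B \<Longrightarrow> Y \<in> Obj C"
  using epireflector by (auto simp: epireflector_def reflector_def)

lemma reflector_adjunction: obtains \<epsilon> where "adjunction C (full_subcat C B) R id_fct r \<epsilon>"
  using epireflector by (auto simp: epireflector_def reflector_def)

lemma reflection_in: "X \<in> Obj C \<Longrightarrow> omap R X \<in> B"
proof -
  obtain \<epsilon> where "adjunction C (full_subcat C B) R id_fct r \<epsilon>" by (rule reflector_adjunction)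
  then interpret adjunction C "full_subcat C B" R id_fct r \<epsilon> .
  show "X \<in> Obj C \<Longrightarrow> omap R X \<in> B"
    using left_adjoint.omap_in by (simp add: full_subcat_simps)
qed

lemma reflector_functor: "cat_functor C C R"
proof -
  obtain \<epsilon> where "adjunction C (full_subcat C B) R id_fct r \<epsilon>" by (rule reflector_adjunction)
  then interpret adjunction C "full_subcat C B" R id_fct r \<epsilon> .
  show ?thesis
  proof
    show "omap R X \<in> Obj C" if "X \<in> Obj C" for X
      by (rule subcat_obj[OF reflection_in[OF that]])
    show "amap R f \<in> Hom C (omap R X) (omap R Y)" if "f \<in> Hom C X Y" for f X Y
      using left_adjoint.amap_in[OF that] by (simp add: Hom_full_subcat)
    show "amap R (Idn C X) = Idn C (omap R X)" if "X \<in> Obj C" for X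
      using left_adjoint.amap_Idn[OF that] by (simp add: full_subcat_simps)
    show "amap R (g \<cdot> f) = amap R g \<cdot> amap R f" if "f \<in> Hom C X Y" "g \<in> Hom C Y Z" for f g X Y Z
      using left_adjoint.amap_Cmp[OF that] by (simp add: full_subcat_simps)
  qed
qed

sublocale R: cat_functor C C R by (rule reflector_functor)

lemma reflection_nat: "nat_trans C C id_fct R r"
proof -
  obtain \<epsilon> where "adjunction C (full_subcat C B) R id_fct r \<epsilon>" by (rule reflector_adjunction)
  then interpret adjunction C "full_subcat C B" R id_fct r \<epsilon> .
  show ?thesis
    using unit.component_in unit.naturality
    by (intro nat_trans.intro nat_trans_axioms.intro cat_functor_id category_axioms
        reflector_functor) (auto simp: id_fct_def comp_fct_def)
qed

lemma reflection_arrow: "X \<in> Obj C \<Longrightarrow> r X \<in> Hom C X (omap R X)"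
  using nat_trans.component_in[OF reflection_nat] by (simp add: id_fct_def)

lemma reflection_natural: "f \<in> Hom C X Y \<Longrightarrow> r Y \<cdot> f = amap R f \<cdot> r X"
  using nat_trans.naturality[OF reflection_nat] by (simp add: id_fct_def)

lemma reflection_cancel:
  assumes X: "X \<in> Obj C" and "f \<in> Hom C (omap R X) Y" "g \<in> Hom C (omap R X) Y"
    and "f \<cdot> r X = g \<cdot> r X"
  shows "f = g"
proof -
  have "epimorphism C (r X)" using epireflector X by (auto simp: epireflector_def)
  moreover have "Cod C (r X) = omap R X" using reflection_arrow[OF X] by (simp add: Hom_def)
  ultimately show ?thesis using assms by (auto simp: epimorphism_def)
qed

text \<open>
  Existence in the universal property of \<open>r\<^sub>X\<close>; the extension is \<open>\<epsilon>\<^sub>Y \<cdot> Rf\<close> for the counit \<open>\<epsilon>\<close>.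
  Uniqueness is \<open>reflection_cancel\<close>.
\<close>
lemma reflection_extend:
  assumes f: "f \<in> Hom C X Y" and Y: "Y \<in> B"
  obtains f' where "f' \<in> Hom C (omap R X) Y" and "f' \<cdot> r X = f"
proof -
  obtain \<epsilon> where "adjunction C (full_subcat C B) R id_fct r \<epsilon>" by (rule reflector_adjunction)
  then interpret adj: adjunction C "full_subcat C B" R id_fct r \<epsilon> .
  have X: "X \<in> Obj C" using f Dom_in by (auto simp: Hom_def)
  have \<epsilon>: "\<epsilon> Y \<in> Hom C (omap R Y) Y"
    using adj.counit.component_in[of Y] Y
    by (simp add: full_subcat_simps Hom_full_subcat id_fct_def comp_fct_def)
  have retr: "\<epsilon> Y \<cdot> r Y = Idn C Y"
    using adj.triangle_right[of Y] Y by (simp add: full_subcat_simps id_fct_def)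
  note Rf = R.amap_in[OF f]
  have "(\<epsilon> Y \<cdot> amap R f) \<cdot> r X = \<epsilon> Y \<cdot> (r Y \<cdot> f)"
    using Cmp_assoc[OF reflection_arrow[OF X] Rf \<epsilon>] reflection_natural[OF f] by simp
  also have "\<dots> = f"
    using Cmp_assoc[OF f reflection_arrow[OF subcat_obj[OF Y]] \<epsilon>] retr Idn_left[OF f] by simp
  finally show ?thesis using that Cmp_in[OF Rf \<epsilon>] by blast
qed

text \<open>
  The inverse in the definition of \<open>refl_mult\<close> is a definite description, so it has to be shown that
  \<open>r\<close> is invertible on objects of \<open>B\<close>: the inverse extends the identity along \<open>r\<close>.
\<close>
lemma refl_mult:
  assumes X: "X \<in> Obj C"
  shows refl_mult_in: "refl_mult C R r X \<in> Hom C (omap R (omap R X)) (omap R X)"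
    and refl_mult_retracts: "refl_mult C R r X \<cdot> r (omap R X) = Idn C (omap R X)"
proof -
  let ?Y = "omap R X"
  have Y: "?Y \<in> B" "?Y \<in> Obj C" using reflection_in[OF X] subcat_obj by auto
  note rY = reflection_arrow[OF Y(2)]
  obtain g where g: "g \<in> Hom C (omap R ?Y) ?Y" "g \<cdot> r ?Y = Idn C ?Y"
    by (rule reflection_extend[OF Idn_in[OF Y(2)] Y(1)])
  have section_g: "r ?Y \<cdot> g = Idn C (omap R ?Y)"
  proof (rule reflection_cancel[OF Y(2)])
    show "r ?Y \<cdot> g \<in> Hom C (omap R ?Y) (omap R ?Y)" by (rule Cmp_in[OF g(1) rY])
    show "Idn C (omap R ?Y) \<in> Hom C (omap R ?Y) (omap R ?Y)" by (rule Idn_in[OF R.omap_in[OF Y(2)]])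
    show "r ?Y \<cdot> g \<cdot> r ?Y = Idn C (omap R ?Y) \<cdot> r ?Y"
      using Cmp_assoc[OF rY g(1) rY] g(2) Idn_right[OF rY] Idn_left[OF rY] by simp
  qed
  have unique: "h = g" if "h \<in> Hom C (omap R ?Y) ?Y" "h \<cdot> r ?Y = Idn C ?Y" for h
    using reflection_cancel[OF Y(2) that(1) g(1)] that(2) g(2) by simp
  have r_Y: "Dom C (r ?Y) = ?Y" "Cod C (r ?Y) = omap R ?Y" using rY by (simp_all add: Hom_def)
  have "refl_mult C R r X = g"
    unfolding refl_mult_def inverse_arrow_def r_Y
    by (rule the_equality) (use g section_g unique in blast)+
  then show "refl_mult C R r X \<in> Hom C (omap R ?Y) ?Y"
    and "refl_mult C R r X \<cdot> r ?Y = Idn C ?Y" using g by simp_all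
qed

end

section \<open>Lifting the reflector to algebras\<close>

locale epireflection_monad =
  epireflection C B R r + T: monad C T \<mu> \<eta>
  for C :: "('o, 'a) cat" (structure) and B R r T \<mu> \<eta> +
  assumes reflected_unit_epi:
      "X \<in> Obj C \<Longrightarrow> epimorphism (full_subcat C B) (amap R (\<eta> X))"
    and unit_split_mono:
      "X \<in> Obj C \<Longrightarrow> split_monomorphism C (\<eta> (omap R (omap T X)))"
begin

abbreviation algs where "algs \<equiv> algebras C T \<mu> \<eta>"
abbreviation Alg where "Alg \<equiv> alg_cat C T \<mu> \<eta>"

lemmas T_in = T.endofunctor.omap_in and Tf_in = T.endofunctor.amap_in

lemma unit_in: "X \<in> Obj C \<Longrightarrow> \<eta> X \<in> Hom C X (omap T X)"
  using T.unit.component_in by (simp add: id_fct_def)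

lemma unit_natural: "f \<in> Hom C X Y \<Longrightarrow> \<eta> Y \<cdot> f = amap T f \<cdot> \<eta> X"
  using T.unit.naturality by (simp add: id_fct_def)

lemma mult_in: "X \<in> Obj C \<Longrightarrow> \<mu> X \<in> Hom C (omap T (omap T X)) (omap T X)"
  using T.multiplication.component_in by (simp add: comp_fct_def)

text \<open>
  By naturality of \<open>r\<close> the arrow \<open>r\<^sub>T\<^sub>Z \<cdot> \<eta>\<^sub>Z\<close> equals \<open>R\<eta>\<^sub>Z \<cdot> r\<^sub>Z\<close>, and both factors are cancellable, the
  first one among arrows of \<open>R(C)\<close>.
\<close>
lemma composite_unit_cancel:
  assumes Z: "Z \<in> Obj C" and Y: "Y \<in> B"
    and f: "f \<in> Hom C (omap R (omap T Z)) Y" and g: "g \<in> Hom C (omap R (omap T Z)) Y"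
    and eq: "f \<cdot> (r (omap T Z) \<cdot> \<eta> Z) = g \<cdot> (r (omap T Z) \<cdot> \<eta> Z)"
  shows "f = g"
proof -
  note \<eta> = unit_in[OF Z] and rZ = reflection_arrow[OF Z]
  note R\<eta> = R.amap_in[OF \<eta>]
  have move: "h \<cdot> (r (omap T Z) \<cdot> \<eta> Z) = (h \<cdot> amap R (\<eta> Z)) \<cdot> r Z"
    if "h \<in> Hom C (omap R (omap T Z)) Y" for h
    using Cmp_assoc[OF rZ R\<eta> that] reflection_natural[OF \<eta>] by simp
  have "f \<cdot> amap R (\<eta> Z) = g \<cdot> amap R (\<eta> Z)"
    using reflection_cancel[OF Z Cmp_in[OF R\<eta> f] Cmp_in[OF R\<eta> g]] eq move[OF f] move[OF g] by simp
  moreover have "Cod C (amap R (\<eta> Z)) = omap R (omap T Z)" using R\<eta> by (simp add: Hom_def)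
  ultimately show ?thesis
    using reflected_unit_epi[OF Z] f g Y reflection_in[OF T_in[OF Z]]
    by (auto simp: epimorphism_def full_subcat_simps Hom_full_subcat)
qed

text \<open>
  Arrows from \<open>TZ\<close> into \<open>B\<close> factor through \<open>r\<^sub>T\<^sub>Z\<close>, which reduces this to \<open>composite_unit_cancel\<close>.
\<close>
lemma unit_cancel:
  assumes Z: "Z \<in> Obj C" and Y: "Y \<in> B"
    and f: "f \<in> Hom C (omap T Z) Y" and g: "g \<in> Hom C (omap T Z) Y"
    and eq: "f \<cdot> \<eta> Z = g \<cdot> \<eta> Z"
  shows "f = g"
proof -
  note \<eta> = unit_in[OF Z] and rT = reflection_arrow[OF T_in[OF Z]]
  obtain f' where f': "f' \<in> Hom C (omap R (omap T Z)) Y" "f' \<cdot> r (omap T Z) = f"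
    by (rule reflection_extend[OF f Y])
  obtain g' where g': "g' \<in> Hom C (omap R (omap T Z)) Y" "g' \<cdot> r (omap T Z) = g"
    by (rule reflection_extend[OF g Y])
  have "f' = g'"
    using composite_unit_cancel[OF Z Y f'(1) g'(1)] eq f'(2) g'(2)
      Cmp_assoc[OF \<eta> rT f'(1)] Cmp_assoc[OF \<eta> rT g'(1)] by simp
  then show ?thesis using f' g' by simp
qed

text \<open>
  The associativity law of the algebra compares arrows \<open>TTY \<rightarrow> Y\<close>; composed with \<open>\<eta>\<^sub>T\<^sub>Y\<close> both sides
  become \<open>s\<close>.
\<close>
lemma retraction_is_algebra:
  assumes Y: "Y \<in> B" and s: "s \<in> Hom C (omap T Y) Y" and retr: "s \<cdot> \<eta> Y = Idn C Y"
  shows "(Y, s) \<in> algs"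
proof -
  note Yo = subcat_obj[OF Y]
  note TY = T_in[OF Yo]
  have "s \<cdot> amap T s = s \<cdot> \<mu> Y"
  proof (rule unit_cancel[OF TY Y])
    show "s \<cdot> amap T s \<in> Hom C (omap T (omap T Y)) Y" by (rule Cmp_in[OF Tf_in[OF s] s])
    show "s \<cdot> \<mu> Y \<in> Hom C (omap T (omap T Y)) Y" by (rule Cmp_in[OF mult_in[OF Yo] s])
    have "s \<cdot> amap T s \<cdot> \<eta> (omap T Y) = s \<cdot> (\<eta> Y \<cdot> s)"
      using Cmp_assoc[OF unit_in[OF TY] Tf_in[OF s] s] unit_natural[OF s] by simp
    also have "\<dots> = s"
      using Cmp_assoc[OF s unit_in[OF Yo] s] retr Idn_left[OF s] by simp
    also have "\<dots> = s \<cdot> \<mu> Y \<cdot> \<eta> (omap T Y)"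
      using Cmp_assoc[OF unit_in[OF TY] mult_in[OF Yo] s] T.unit_left[OF Yo] Idn_right[OF s] by simp
    finally show "s \<cdot> amap T s \<cdot> \<eta> (omap T Y) = s \<cdot> \<mu> Y \<cdot> \<eta> (omap T Y)" .
  qed
  then show ?thesis using Yo s retr by (simp add: algebras_def)
qed

text \<open>
  Both sides of the homomorphism equation are arrows \<open>TX \<rightarrow> Y\<close> whose composite with \<open>\<eta>\<^sub>X\<close> is \<open>f\<close>.
\<close>
lemma alg_homs_into_subcat:
  assumes A: "(X, a) \<in> algs" and A': "(Y, b) \<in> algs" and Y: "Y \<in> B" and f: "f \<in> Hom C X Y"
  shows "f \<in> alg_homs C T (X, a) (Y, b)"
proof -
  note a = algebrasD[OF A] and b = algebrasD[OF A']
  have "f \<cdot> a = b \<cdot> amap T f"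
  proof (rule unit_cancel[OF a(1) Y])
    show "f \<cdot> a \<in> Hom C (omap T X) Y" by (rule Cmp_in[OF a(2) f])
    show "b \<cdot> amap T f \<in> Hom C (omap T X) Y" by (rule Cmp_in[OF Tf_in[OF f] b(2)])
    have "f \<cdot> a \<cdot> \<eta> X = f"
      using Cmp_assoc[OF unit_in[OF a(1)] a(2) f] a(4) Idn_right[OF f] by simp
    also have "\<dots> = b \<cdot> (\<eta> Y \<cdot> f)"
      using Cmp_assoc[OF f unit_in[OF b(1)] b(2)] b(4) Idn_left[OF f] by simp
    also have "\<dots> = b \<cdot> amap T f \<cdot> \<eta> X"
      using Cmp_assoc[OF unit_in[OF a(1)] Tf_in[OF f] b(2)] unit_natural[OF f] by simp
    finally show "f \<cdot> a \<cdot> \<eta> X = b \<cdot> amap T f \<cdot> \<eta> X" .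
  qed
  then show ?thesis using f by (simp add: alg_homs_def)
qed

text \<open>
  A retract of an object with split unit has split unit, and \<open>RX\<close> is a retract of \<open>RTX\<close> through
  \<open>R\<eta>\<^sub>X\<close> and \<open>Ra\<close>.
\<close>
lemma unit_split_mono_of_algebra:
  assumes A: "(X, a) \<in> algs"
  obtains s where "s \<in> Hom C (omap T (omap R X)) (omap R X)"
    and "s \<cdot> \<eta> (omap R X) = Idn C (omap R X)"
proof -
  note a = algebrasD[OF A]
  note X = a(1) and Ra = R.amap_in[OF a(2)] and R\<eta> = R.amap_in[OF unit_in[OF a(1)]]
  note RX = R.omap_in[OF X] and RTX = R.omap_in[OF T_in[OF X]]
  have \<eta>: "\<eta> (omap R (omap T X)) \<in> Hom C (omap R (omap T X)) (omap T (omap R (omap T X)))"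
    by (rule unit_in[OF RTX])
  obtain s where s: "s \<in> Hom C (omap T (omap R (omap T X))) (omap R (omap T X))"
    "s \<cdot> \<eta> (omap R (omap T X)) = Idn C (omap R (omap T X))"
    using unit_split_mono[OF X] \<eta> by (auto simp: split_monomorphism_def Hom_def)
  \<comment> \<open>The composite \<open>TRX \<rightarrow> TRTX \<rightarrow> RTX \<rightarrow> RX\<close> of \<open>TR\<eta>\<^sub>X\<close>, the given retraction and \<open>Ra\<close>.\<close>
  let ?t = "amap R a \<cdot> (s \<cdot> amap T (amap R (\<eta> X)))"
  note TR\<eta> = Tf_in[OF R\<eta>]
  note sT = Cmp_in[OF TR\<eta> s(1)]
  have "s \<cdot> amap T (amap R (\<eta> X)) \<cdot> \<eta> (omap R X) = s \<cdot> (\<eta> (omap R (omap T X)) \<cdot> amap R (\<eta> X))"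
    using Cmp_assoc[OF unit_in[OF RX] TR\<eta> s(1)] unit_natural[OF R\<eta>] by simp
  also have "\<dots> = amap R (\<eta> X)"
    using Cmp_assoc[OF R\<eta> \<eta> s(1)] s(2) Idn_left[OF R\<eta>] by simp
  finally have "?t \<cdot> \<eta> (omap R X) = amap R a \<cdot> amap R (\<eta> X)"
    using Cmp_assoc[OF unit_in[OF RX] sT Ra] by simp
  also have "\<dots> = Idn C (omap R X)"
    using R.amap_Cmp[OF unit_in[OF X] a(2)] a(4) R.amap_Idn[OF X] by simp
  finally show ?thesis using that Cmp_in[OF sT Ra] by blast
qed

text \<open>
  The choice is harmless: by \<open>unit_cancel\<close> there is at most one retraction when \<open>Y \<in> B\<close>. In
  particular the structure of the lifted algebra depends only on the carrier.
\<close>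
definition unit_retraction :: "'o \<Rightarrow> 'a" where
  "unit_retraction Y = (SOME s. s \<in> Hom C (omap T Y) Y \<and> s \<cdot> \<eta> Y = Idn C Y)"

definition lift_obj :: "('o, 'a) alg \<Rightarrow> ('o, 'a) alg" where
  "lift_obj A = (omap R (fst A), unit_retraction (omap R (fst A)))"

definition lift :: "(('o, 'a) alg, ('o, 'a) alg_arr, ('o, 'a) alg, ('o, 'a) alg_arr) fct" where
  "lift = \<lparr>omap = lift_obj, amap = (\<lambda>(A, f, A'). (lift_obj A, amap R f, lift_obj A'))\<rparr>"

definition lift_unit :: "('o, 'a) alg \<Rightarrow> ('o, 'a) alg_arr" where
  "lift_unit A = (A, r (fst A), lift_obj A)"

definition lift_mult :: "('o, 'a) alg \<Rightarrow> ('o, 'a) alg_arr" where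
  "lift_mult A = (lift_obj (lift_obj A), refl_mult C R r (fst A), lift_obj A)"

lemma fst_lift_obj [simp]: "fst (lift_obj A) = omap R (fst A)"
  by (simp add: lift_obj_def)

lemma fst_algs: "A \<in> algs \<Longrightarrow> fst A \<in> Obj C"
  by (cases A) (auto dest: algebrasD)

lemma lift_obj_in:
  assumes "A \<in> algs"
  shows "lift_obj A \<in> algs"
proof -
  obtain X a where A: "A = (X, a)" by (cases A)
  have "\<exists>s. s \<in> Hom C (omap T (omap R X)) (omap R X) \<and> s \<cdot> \<eta> (omap R X) = Idn C (omap R X)"
    using unit_split_mono_of_algebra assms A by blast
  from someI_ex[OF this]
  have "unit_retraction (omap R X) \<in> Hom C (omap T (omap R X)) (omap R X)"
    and "unit_retraction (omap R X) \<cdot> \<eta> (omap R X) = Idn C (omap R X)"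
    unfolding unit_retraction_def by auto
  moreover have "omap R X \<in> B" using reflection_in[OF fst_algs[OF assms]] A by simp
  ultimately show ?thesis using retraction_is_algebra A by (simp add: lift_obj_def)
qed

text \<open>
  Since the carrier of \<open>lift_obj A'\<close> lies in \<open>B\<close>, the functor \<open>lift\<close>, its unit and its multiplication
  are well defined as soon as their underlying arrows are.
\<close>
lemma Hom_into_lift:
  assumes A: "A \<in> algs" and A': "A' \<in> algs" and f: "f \<in> Hom C (fst A) (omap R (fst A'))"
  shows "(A, f, lift_obj A') \<in> Hom Alg A (lift_obj A')"
  using alg_homs_into_subcat[of "fst A" "snd A" _ _ f] A lift_obj_in[OF A'] f
    reflection_in[OF fst_algs[OF A']]
  by (auto simp: Hom_alg_cat_iff lift_obj_def)

lemma category_Alg: "category Alg"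
  by (rule category_alg_cat[OF T.endofunctor.cat_functor_axioms])

lemma lift_functor: "cat_functor Alg Alg lift"
proof (intro cat_functor.intro cat_functor_axioms.intro category_Alg)
  show "omap lift A \<in> Obj Alg" if "A \<in> Obj Alg" for A
    using that lift_obj_in by (simp add: lift_def alg_cat_simps)
  show "amap lift h \<in> Hom Alg (omap lift P) (omap lift Q)" if h: "h \<in> Hom Alg P Q" for h P Q
    by (rule Hom_alg_catE[OF h])
      (auto simp: lift_def intro!: Hom_into_lift lift_obj_in R.amap_in)
  show "amap lift (Idn Alg A) = Idn Alg (omap lift A)" if "A \<in> Obj Alg" for A
    using that fst_algs by (simp add: lift_def alg_cat_simps R.amap_Idn)
  show "amap lift (k \<cdot>\<^bsub>Alg\<^esub> h) = amap lift k \<cdot>\<^bsub>Alg\<^esub> amap lift h"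
    if h: "h \<in> Hom Alg P Q" and k: "k \<in> Hom Alg Q S" for h k P Q S
    by (rule Hom_alg_catE[OF h]; rule Hom_alg_catE[OF k])
      (auto simp: lift_def alg_cat_simps intro: R.amap_Cmp)
qed

lemma lift_unit_natural: "nat_trans Alg Alg id_fct lift lift_unit"
proof (intro nat_trans.intro nat_trans_axioms.intro lift_functor cat_functor_id category_Alg)
  show "lift_unit A \<in> Hom Alg (omap id_fct A) (omap lift A)" if "A \<in> Obj Alg" for A
    using that
    by (auto simp: lift_unit_def id_fct_def lift_def alg_cat_simps
        intro!: Hom_into_lift reflection_arrow fst_algs simp del: split_paired_All)
  show "lift_unit Q \<cdot>\<^bsub>Alg\<^esub> amap id_fct h = amap lift h \<cdot>\<^bsub>Alg\<^esub> lift_unit P"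
    if h: "h \<in> Hom Alg P Q" for h P Q
    by (rule Hom_alg_catE[OF h])
      (auto simp: lift_unit_def id_fct_def lift_def alg_cat_simps intro: reflection_natural)
qed

text \<open>
  Cancellability of the unit is inherited from \<open>r\<close>, since parallel arrows of algebras are equal when
  their underlying arrows are.
\<close>
lemma lift_monad: "monad Alg lift lift_mult lift_unit"
proof (rule monad_if_unit_cancellable[OF lift_unit_natural])
  fix A assume "A \<in> Obj Alg"
  then have A: "A \<in> algs" by (simp add: alg_cat_simps)
  show "lift_mult A \<in> Hom Alg (omap lift (omap lift A)) (omap lift A)"
    using Hom_into_lift[OF lift_obj_in[OF lift_obj_in[OF A]] A] refl_mult_in[OF fst_algs[OF A]]
    by (simp add: lift_def lift_mult_def)
  show "lift_mult A \<cdot>\<^bsub>Alg\<^esub> lift_unit (omap lift A) = Idn Alg (omap lift A)"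
    using refl_mult_retracts[OF fst_algs[OF A]]
    by (simp add: lift_def lift_mult_def lift_unit_def alg_cat_simps)
next
  fix P Q g h
  assume P: "P \<in> Obj Alg" and g: "g \<in> Hom Alg (omap lift P) (omap lift Q)"
    and h: "h \<in> Hom Alg (omap lift P) (omap lift Q)"
    and eq: "g \<cdot>\<^bsub>Alg\<^esub> lift_unit P = h \<cdot>\<^bsub>Alg\<^esub> lift_unit P"
  obtain g' where g': "g = (lift_obj P, g', lift_obj Q)"
    "g' \<in> Hom C (omap R (fst P)) (omap R (fst Q))"
    using g by (rule Hom_alg_catE) (auto simp: lift_def lift_obj_def)
  obtain h' where h': "h = (lift_obj P, h', lift_obj Q)"
    "h' \<in> Hom C (omap R (fst P)) (omap R (fst Q))"
    using h by (rule Hom_alg_catE) (auto simp: lift_def lift_obj_def)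
  have "g' = h'"
  proof (rule reflection_cancel)
    show "fst P \<in> Obj C" using P by (simp add: alg_cat_simps fst_algs)
    show "g' \<cdot> r (fst P) = h' \<cdot> r (fst P)"
      using eq g'(1) h'(1) by (simp add: lift_unit_def alg_cat_simps)
  qed (use g' h' in auto)
  then show "g = h" using g' h' by simp
qed

lemma lift_is_lifting: "is_lifting C R r T \<mu> \<eta> lift lift_mult lift_unit"
  using lift_monad
  by (auto simp: is_lifting_def fct_eq_on_def forget_fct_def comp_fct_def lift_def lift_obj_def
      lift_unit_def lift_mult_def alg_cat_def)

section \<open>The composite monad\<close>

lemma free_algebra: "X \<in> Obj C \<Longrightarrow> (omap T X, \<mu> X) \<in> algs"
  using T_in mult_in T.associativity T.unit_left by (simp add: algebras_def)

definition comp_unit :: "'o \<Rightarrow> 'a" where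
  "comp_unit X = r (omap T X) \<cdot> \<eta> X"

text \<open>
  The unique extension along \<open>r\<close> of the structure map \<open>TRTX \<rightarrow> RTX\<close> of the lifted free algebra.
\<close>
definition comp_mult :: "'o \<Rightarrow> 'a" where
  "comp_mult X = (SOME v. v \<in> Hom C (omap R (omap T (omap R (omap T X)))) (omap R (omap T X)) \<and>
    v \<cdot> r (omap T (omap R (omap T X))) = snd (lift_obj (omap T X, \<mu> X)))"

lemma comp_mult:
  assumes X: "X \<in> Obj C"
  shows comp_mult_in: "comp_mult X \<in> Hom C (omap R (omap T (omap R (omap T X)))) (omap R (omap T X))"
    and comp_mult_extends:
      "comp_mult X \<cdot> r (omap T (omap R (omap T X))) = snd (lift_obj (omap T X, \<mu> X))"
proof -
  have "lift_obj (omap T X, \<mu> X) \<in> algs" by (rule lift_obj_in[OF free_algebra[OF X]])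
  then have "snd (lift_obj (omap T X, \<mu> X)) \<in> Hom C (omap T (omap R (omap T X))) (omap R (omap T X))"
    by (auto simp: lift_obj_def dest: algebrasD)
  from reflection_extend[OF this reflection_in[OF T_in[OF X]]]
  have "\<exists>v. v \<in> Hom C (omap R (omap T (omap R (omap T X)))) (omap R (omap T X)) \<and>
    v \<cdot> r (omap T (omap R (omap T X))) = snd (lift_obj (omap T X, \<mu> X))" by blast
  from someI_ex[OF this]
  show "comp_mult X \<in> Hom C (omap R (omap T (omap R (omap T X)))) (omap R (omap T X))"
    and "comp_mult X \<cdot> r (omap T (omap R (omap T X))) = snd (lift_obj (omap T X, \<mu> X))"
    unfolding comp_mult_def by auto
qed

lemma comp_mult_is_composite_mult: "is_composite_mult C R r T \<mu> lift comp_mult"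
proof -
  have "v = comp_mult X"
    if X: "X \<in> Obj C" and v: "v \<in> Hom C (omap R (omap T (omap R (omap T X)))) (omap R (omap T X))"
      "v \<cdot> r (omap T (omap R (omap T X))) = snd (lift_obj (omap T X, \<mu> X))" for X v
    using reflection_cancel[OF T_in[OF R.omap_in[OF T_in[OF X]]] v(1) comp_mult_in[OF X]]
      v(2) comp_mult_extends[OF X] by simp
  then show ?thesis
    using comp_mult by (auto simp: is_composite_mult_def comp_fct_def lift_def)
qed

lemma comp_unit_in: "X \<in> Obj C \<Longrightarrow> comp_unit X \<in> Hom C X (omap R (omap T X))"
  unfolding comp_unit_def by (rule Cmp_in[OF unit_in reflection_arrow[OF T_in]])

lemma comp_unit_natural: "nat_trans C C id_fct (R \<circ>\<^sub>F T) comp_unit"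
proof (intro nat_trans.intro nat_trans_axioms.intro cat_functor_id category_axioms
    cat_functor_comp[OF T.endofunctor.cat_functor_axioms R.cat_functor_axioms])
  show "comp_unit X \<in> Hom C (omap id_fct X) (omap (R \<circ>\<^sub>F T) X)" if "X \<in> Obj C" for X
    using comp_unit_in[OF that] by (simp add: id_fct_def comp_fct_def)
  show "comp_unit Y \<cdot> amap id_fct f = amap (R \<circ>\<^sub>F T) f \<cdot> comp_unit X"
    if f: "f \<in> Hom C X Y" for f X Y
  proof -
    have X: "X \<in> Obj C" and Y: "Y \<in> Obj C" using f Dom_in Cod_in by (auto simp: Hom_def)
    note rX = reflection_arrow[OF T_in[OF X]] and rY = reflection_arrow[OF T_in[OF Y]]
    note Tf = Tf_in[OF f]
    have "comp_unit Y \<cdot> f = r (omap T Y) \<cdot> (amap T f \<cdot> \<eta> X)"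
      using Cmp_assoc[OF f unit_in[OF Y] rY] unit_natural[OF f] by (simp add: comp_unit_def)
    also have "\<dots> = amap R (amap T f) \<cdot> comp_unit X"
      using Cmp_assoc[OF unit_in[OF X] Tf rY] reflection_natural[OF Tf]
        Cmp_assoc[OF unit_in[OF X] rX R.amap_in[OF Tf]] by (simp add: comp_unit_def)
    finally show ?thesis by (simp add: id_fct_def comp_fct_def)
  qed
qed

text \<open>
  This is the unit law of the lifted free algebra.
\<close>
lemma comp_mult_retracts:
  assumes X: "X \<in> Obj C"
  shows "comp_mult X \<cdot> comp_unit (omap R (omap T X)) = Idn C (omap R (omap T X))"
proof -
  note RTX = R.omap_in[OF T_in[OF X]]
  have "lift_obj (omap T X, \<mu> X) \<in> algs" by (rule lift_obj_in[OF free_algebra[OF X]])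
  then have "snd (lift_obj (omap T X, \<mu> X)) \<cdot> \<eta> (omap R (omap T X)) = Idn C (omap R (omap T X))"
    by (auto simp: lift_obj_def dest: algebrasD)
  then show ?thesis
    using Cmp_assoc[OF unit_in[OF RTX] reflection_arrow[OF T_in[OF RTX]] comp_mult_in[OF X]]
      comp_mult_extends[OF X] by (simp add: comp_unit_def)
qed

lemma comp_monad: "monad C (R \<circ>\<^sub>F T) comp_mult comp_unit"
proof (rule monad_if_unit_cancellable[OF comp_unit_natural])
  fix X Y f g
  assume X: "X \<in> Obj C" and Y: "Y \<in> Obj C"
    and "f \<in> Hom C (omap (R \<circ>\<^sub>F T) X) (omap (R \<circ>\<^sub>F T) Y)"
    and "g \<in> Hom C (omap (R \<circ>\<^sub>F T) X) (omap (R \<circ>\<^sub>F T) Y)"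
    and "f \<cdot> comp_unit X = g \<cdot> comp_unit X"
  then show "f = g"
    using composite_unit_cancel[OF X reflection_in[OF T_in[OF Y]]]
    by (simp add: comp_fct_def comp_unit_def)
qed (simp_all add: comp_fct_def comp_mult_in comp_mult_retracts)

lemma composite_monad: "forms_composite_monad C R r T \<mu> \<eta>"
proof -
  have "comp_unit = (\<lambda>X. r (omap T X) \<cdot> \<eta> X)" by (simp add: fun_eq_iff comp_unit_def)
  then show ?thesis
    unfolding forms_composite_monad_def
    using lift_is_lifting comp_mult_is_composite_mult comp_monad by metis
qed

end

theorem corollary21:
  fixes C :: "('o, 'a) cat" and B :: "'o set"
    and R T :: "('o, 'a, 'o, 'a) fct" and r \<mu> \<eta> :: "'o \<Rightarrow> 'a"
  assumes "epireflector C B R r"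
    and "monad C T \<mu> \<eta>"
    and "\<And>X. X \<in> Obj C \<Longrightarrow> epimorphism (full_subcat C B) (amap R (\<eta> X))"
    and "\<And>X. X \<in> Obj C \<Longrightarrow> split_monomorphism C (\<eta> (omap R (omap T X)))"
  shows "forms_composite_monad C R r T \<mu> \<eta>"
proof -
  have "category C" using assms(1) by (simp add: epireflector_def reflector_def)
  then interpret epireflection_monad C B R r T \<mu> \<eta>
    using assms by (intro epireflection_monad.intro epireflection.intro
        epireflection_axioms.intro epireflection_monad_axioms.intro)
  show ?thesis by (rule composite_monad)
qed

end
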